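(* Let $r$ be a positive integer. The total count of absentee-voxels in the hemisphere of revolution $\mathcal H_\cup^{\mathbb Z}(r)$ equals $|\mathcal A^{\mathbb Z^2}(r)|$, the number of disc absentees of $\mathcal D_\cup^{\mathbb Z}(r)$, and $|\mathcal A^{\mathbb Z^2}(r)|=\Theta(r^2)$ as $r\to\infty$.
   Context: Digital circle of integer radius $r\ge 0$ centered at the origin: $\mathcal C^{\mathbb Z}(r)=\{(i,j)\in\mathbb Z^2: |\max(|i|,|j|)-\sqrt{r^2-\min(|i|,|j|)^2}|<\tfrac12\}$ (points for which the square root is not real are excluded). Digital disc: $\mathcal D^{\mathbb Z}(r)$ is the set of all $(i,j_c)\in\mathbb Z^2$ for which there is $(i_c,j_c)\in\mathcal C^{\mathbb Z}(r)$ with $i$ between $0$ and $i_c$ inclusive. The interior of $\mathcal C^{\mathbb Z}(r)$ is $\mathcal D^{\mathbb Z}(r)\setminus\mathcal C^{\mathbb Z}(r)$ and its exterior is $\mathbb Z^2\setminus\mathcal D^{\mathbb Z}(r)$. Put $\mathcal D_\cup^{\mathbb Z}(r)=\bigcup_{s=0}^{r}\mathcal C^{\mathbb Z}(s)$. The set of disc absentees is $\mathcal A^{\mathbb Z^2}(r)=\mathcal D^{\mathbb Z}(r)\setminus\mathcal D_\cup^{\mathbb Z}(r)$; equivalently, a pixel is a disc absentee iff for some $r'\in\{1,\dots,r\}$ it is in the interior of $\mathcal C^{\mathbb Z}(r')$ and in the exterior of $\mathcal C^{\mathbb Z}(r'-1)$. Coordinates in $\mathbb Z^3$ are $(x,y,z)$.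 For $c=(0,j,0)$ and an integer $i\ge0$, $\mathcal C^{\mathbb Z}(c,i)=\{(x,j,z):(x,z)\in\mathcal C^{\mathbb Z}(i)\}$, with interior and exterior taken within the plane $y=j$. The generatrix $\mathcal C_{1,2}^{\mathbb Z}(r)$ is the part of $\mathcal C^{\mathbb Z}(r)$ in the first quadrant $\{i\ge0,\ j\ge0\}$, regarded as a sequence of points ordered from $(0,r)$ to $(r,0)$. The hemisphere of revolution is $\mathcal H_\cup^{\mathbb Z}(r)=\bigcup_{(i,j)\in\mathcal C_{1,2}^{\mathbb Z}(r)}\mathcal C^{\mathbb Z}((0,j,0),i)$. A voxel $p$ in the plane $y=j$ is an absentee-voxel of $\mathcal H_\cup^{\mathbb Z}(r)$ (sphere absentee) iff there are two consecutive points $(i,j)$ and $(i-1,j')$, $j'\in\{j,j+1\}$, of the generatrix such that $p$ lies in the interior of $\mathcal C^{\mathbb Z}(c,i)$ and in the exterior of $\mathcal C^{\mathbb Z}(c,i-1)$, where $c=(0,j,0)$. *)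

theory Defs
  imports Complex_Main "HOL-Library.Landau_Symbols"
begin

type_synonym pixel = "int \<times> int"
type_synonym voxel = "int \<times> int \<times> int"

(* sqrt is total in HOL (sqrt (- x) = - sqrt x), so realness of the root is required explicitly. *)
definition digital_circle :: "nat \<Rightarrow> pixel set" where
  "digital_circle r = {(i, j).
     (min \<bar>i\<bar> \<bar>j\<bar>)\<^sup>2 \<le> (int r)\<^sup>2 \<and>
     \<bar>real_of_int (max \<bar>i\<bar> \<bar>j\<bar>)
        - sqrt ((real r)\<^sup>2 - (real_of_int (min \<bar>i\<bar> \<bar>j\<bar>))\<^sup>2)\<bar> < 1 / 2}"

definition digital_disc :: "nat \<Rightarrow> pixel set" where
  "digital_disc r = {(i, j). \<exists>ic. (ic, j) \<in> digital_circle r \<and> min 0 ic \<le> i \<and> i \<le> max 0 ic}"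

definition circle_interior :: "nat \<Rightarrow> pixel set" where
  "circle_interior r = digital_disc r - digital_circle r"

definition circle_exterior :: "nat \<Rightarrow> pixel set" where
  "circle_exterior r = - digital_disc r"

definition disc_union :: "nat \<Rightarrow> pixel set" where
  "disc_union r = (\<Union>s\<in>{0..r}. digital_circle s)"

definition disc_absentees :: "nat \<Rightarrow> pixel set" where
  "disc_absentees r = digital_disc r - disc_union r"

(* The copy of a set of pixels (x, z) in the plane y = j. *)
definition in_plane :: "int \<Rightarrow> pixel set \<Rightarrow> voxel set" where
  "in_plane j A = {(x, y, z). y = j \<and> (x, z) \<in> A}"

definition generatrix :: "nat \<Rightarrow> pixel set" where
  "generatrix r = {(i, j). (i, j) \<in> digital_circle r \<and> 0 \<le> i \<and> 0 \<le> j}"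

definition hemisphere :: "nat \<Rightarrow> voxel set" where
  "hemisphere r = (\<Union>(i, j)\<in>generatrix r. in_plane j (digital_circle (nat i)))"

(* Order of traversal of the first-quadrant arc from (0, r) to (r, 0): the abscissa never
   decreases, and pixels in the same column are visited downwards. *)
definition precedes :: "pixel \<Rightarrow> pixel \<Rightarrow> bool" where
  "precedes p q \<longleftrightarrow> fst p < fst q \<or> (fst p = fst q \<and> snd p > snd q)"

definition consecutive :: "nat \<Rightarrow> pixel \<Rightarrow> pixel \<Rightarrow> bool" where
  "consecutive r p q \<longleftrightarrow>
     p \<in> generatrix r \<and> q \<in> generatrix r \<and> precedes p q \<and>
     \<not> (\<exists>m\<in>generatrix r. precedes p m \<and> precedes m q)"

(* The absentee-voxels of hemisphere r; they are determined by the generatrix that is revolved.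
   Membership of (i - 1, j') in the generatrix forces 1 \<le> i, so both conversions by nat are exact. *)
definition absentee_voxels :: "nat \<Rightarrow> voxel set" where
  "absentee_voxels r = {p. \<exists>i j j'. consecutive r (i - 1, j') (i, j) \<and> j' \<in> {j, j + 1} \<and>
     p \<in> in_plane j (circle_interior (nat i)) \<and>
     p \<in> in_plane j (circle_exterior (nat (i - 1)))}"

(* Finiteness of both sets, so that card really counts their elements. *)

lemma digital_circle_bound:
  assumes "(i, j) \<in> digital_circle r"
  shows "\<bar>i\<bar> \<le> int r \<and> \<bar>j\<bar> \<le> int r"
proof -
  let ?m = "min \<bar>i\<bar> \<bar>j\<bar>" and ?M = "max \<bar>i\<bar> \<bar>j\<bar>"
  have "sqrt ((real r)\<^sup>2 - (real_of_int ?m)\<^sup>2) \<le> sqrt ((real r)\<^sup>2)"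
    by (rule real_sqrt_le_mono) simp
  then have "sqrt ((real r)\<^sup>2 - (real_of_int ?m)\<^sup>2) \<le> real r"
    by simp
  moreover have "\<bar>real_of_int ?M - sqrt ((real r)\<^sup>2 - (real_of_int ?m)\<^sup>2)\<bar> < 1 / 2"
    using assms by (simp add: digital_circle_def)
  ultimately have "real_of_int ?M < real r + 1 / 2"
    by linarith
  then have "?M \<le> int r"
    by linarith
  then show ?thesis
    by simp
qed

lemma digital_disc_bound: "digital_disc r \<subseteq> {- int r..int r} \<times> {- int r..int r}"
  by (fastforce simp: digital_disc_def dest: digital_circle_bound)

lemma finite_digital_disc: "finite (digital_disc r)"
  by (rule finite_subset[OF digital_disc_bound]) simp

lemma finite_disc_absentees: "finite (disc_absentees r)"
  by (simp add: disc_absentees_def finite_digital_disc)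

lemma finite_absentee_voxels: "finite (absentee_voxels r)"
proof (rule finite_subset)
  let ?I = "{- int r..int r}"
  show "absentee_voxels r \<subseteq> ?I \<times> ?I \<times> ?I"
  proof
    fix p assume "p \<in> absentee_voxels r"
    then obtain i j where g: "(i, j) \<in> generatrix r"
      and p: "p \<in> in_plane j (circle_interior (nat i))"
      unfolding absentee_voxels_def consecutive_def by blast
    have ij: "0 \<le> i" "i \<le> int r" "\<bar>j\<bar> \<le> int r"
      using g digital_circle_bound[of i j r] by (auto simp: generatrix_def)
    obtain x z where xz: "p = (x, j, z)" "(x, z) \<in> digital_disc (nat i)"
      using p by (auto simp: in_plane_def circle_interior_def)
    then have "\<bar>x\<bar> \<le> i" "\<bar>z\<bar> \<le> i"
      using subsetD[OF digital_disc_bound xz(2)] ij(1) by auto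
    then show "p \<in> ?I \<times> ?I \<times> ?I"
      using xz(1) ij by auto
  qed
  show "finite (?I \<times> ?I \<times> ?I)"
    by simp
qed

end

theory Submission
  imports Defs
begin

text \<open>Squaring away the root, a pixel other than the origin with \<open>N = i\<^sup>2 + j\<^sup>2\<close> and
  \<open>k = max \<bar>i\<bar> \<bar>j\<bar>\<close> lies on the circle of radius \<open>r\<close> iff \<open>N - k < r\<^sup>2 \<le> N + k\<close>, and in the disc
  iff \<open>N - k < r\<^sup>2\<close>.  So it is a disc absentee iff \<open>(s - 1)\<^sup>2 \<le> N - k\<close> and \<open>N + k < s\<^sup>2\<close> for some
  \<open>s \<le> r\<close>, which is then unique.  For each \<open>s\<close> in \<open>{1..r}\<close> exactly one height \<open>y\<close> occurs at which the
  generatrix steps from abscissa \<open>s - 1\<close> to \<open>s\<close>, so forgetting \<open>y\<close> is a bijection from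
  absentee-voxels to disc absentees.  The quadratic lower bound comes from finding an absentee in
  every block of 40 consecutive pixels in a sector of positive angle.\<close>

section \<open>Circles as integer inequalities\<close>

text \<open>The correction at the origin makes it belong to the circle of radius 0.\<close>

definition inner_sq :: "int \<Rightarrow> int \<Rightarrow> int" where
  "inner_sq i j = i\<^sup>2 + j\<^sup>2 - max \<bar>i\<bar> \<bar>j\<bar> - (if i = 0 \<and> j = 0 then 1 else 0)"

definition outer_sq :: "int \<Rightarrow> int \<Rightarrow> int" where
  "outer_sq i j = i\<^sup>2 + j\<^sup>2 + max \<bar>i\<bar> \<bar>j\<bar>"

text \<open>The squares of \<open>k + 1 / 2\<close> and \<open>k - 1 / 2\<close> lie a quarter above
  integers, so the strict real inequalities round to integer ones.\<close>

lemma abs_diff_sqrt_less_half_iff: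
  fixes a k :: int
  assumes "0 \<le> a" and "1 \<le> k"
  shows "\<bar>real_of_int k - sqrt (real_of_int a)\<bar> < 1 / 2 \<longleftrightarrow> k\<^sup>2 - k < a \<and> a \<le> k\<^sup>2 + k"
proof -
  have sqrt_sq: "sqrt ((real_of_int k + 1 / 2)\<^sup>2) = real_of_int k + 1 / 2"
    "sqrt ((real_of_int k - 1 / 2)\<^sup>2) = real_of_int k - 1 / 2"
    using assms(2) by simp_all
  have "sqrt (real_of_int a) < real_of_int k + 1 / 2 \<longleftrightarrow> real_of_int a < (real_of_int k + 1 / 2)\<^sup>2"
    using sqrt_sq(1) real_sqrt_less_iff by metis
  also have "(real_of_int k + 1 / 2)\<^sup>2 = real_of_int (k\<^sup>2 + k) + 1 / 4"
    by (simp add: power2_eq_square algebra_simps)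
  also have "real_of_int a < real_of_int (k\<^sup>2 + k) + 1 / 4 \<longleftrightarrow> a \<le> k\<^sup>2 + k"
    by linarith
  finally have upper: "sqrt (real_of_int a) < real_of_int k + 1 / 2 \<longleftrightarrow> a \<le> k\<^sup>2 + k" .
  have "real_of_int k - 1 / 2 < sqrt (real_of_int a) \<longleftrightarrow> (real_of_int k - 1 / 2)\<^sup>2 < real_of_int a"
    using sqrt_sq(2) real_sqrt_less_iff by metis
  also have "(real_of_int k - 1 / 2)\<^sup>2 = real_of_int (k\<^sup>2 - k) + 1 / 4"
    by (simp add: power2_eq_square algebra_simps)
  also have "real_of_int (k\<^sup>2 - k) + 1 / 4 < real_of_int a \<longleftrightarrow> k\<^sup>2 - k < a"
    by linarith
  finally have "real_of_int k - 1 / 2 < sqrt (real_of_int a) \<longleftrightarrow> k\<^sup>2 - k < a" .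
  moreover have "\<bar>real_of_int k - sqrt (real_of_int a)\<bar> < 1 / 2 \<longleftrightarrow>
      real_of_int k - 1 / 2 < sqrt (real_of_int a) \<and> sqrt (real_of_int a) < real_of_int k + 1 / 2"
    unfolding abs_less_iff by linarith
  ultimately show ?thesis using upper by simp
qed

lemma digital_circle_iff:
  "(i, j) \<in> digital_circle r \<longleftrightarrow> inner_sq i j < (int r)\<^sup>2 \<and> (int r)\<^sup>2 \<le> outer_sq i j"
proof (cases "i = 0 \<and> j = 0")
  case True
  moreover have "- 1 < (int r)\<^sup>2" using zero_le_power2[of "int r"] by linarith
  ultimately show ?thesis
    by (auto simp: digital_circle_def inner_sq_def outer_sq_def)
next
  case False
  define k where "k = max \<bar>i\<bar> \<bar>j\<bar>"
  define m where "m = min \<bar>i\<bar> \<bar>j\<bar>"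
  have k: "1 \<le> k" using False by (auto simp: k_def)
  have sq: "i\<^sup>2 + j\<^sup>2 = k\<^sup>2 + m\<^sup>2"
    by (auto simp: k_def m_def max_def min_def)
  \<comment> \<open>The bound on \<open>inner_sq\<close> alone makes the root real.\<close>
  have "k \<le> k\<^sup>2" using k by (simp add: power2_eq_square)
  then have bound: "m\<^sup>2 \<le> (int r)\<^sup>2" if "inner_sq i j < (int r)\<^sup>2"
    using that False sq by (simp add: inner_sq_def k_def[symmetric])
  have "(real r)\<^sup>2 - (real_of_int m)\<^sup>2 = real_of_int ((int r)\<^sup>2 - m\<^sup>2)"
    by simp
  then have "(i, j) \<in> digital_circle r \<longleftrightarrow> m\<^sup>2 \<le> (int r)\<^sup>2 \<and>
      \<bar>real_of_int k - sqrt (real_of_int ((int r)\<^sup>2 - m\<^sup>2))\<bar> < 1 / 2"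
    by (simp add: digital_circle_def k_def m_def)
  also have "\<dots> \<longleftrightarrow> m\<^sup>2 \<le> (int r)\<^sup>2 \<and>
      k\<^sup>2 - k < (int r)\<^sup>2 - m\<^sup>2 \<and> (int r)\<^sup>2 - m\<^sup>2 \<le> k\<^sup>2 + k"
    using abs_diff_sqrt_less_half_iff[of "(int r)\<^sup>2 - m\<^sup>2" k] k by auto
  also have "\<dots> \<longleftrightarrow> inner_sq i j < (int r)\<^sup>2 \<and> (int r)\<^sup>2 \<le> outer_sq i j"
    using bound False sq by (auto simp: inner_sq_def outer_sq_def k_def[symmetric])
  finally show ?thesis .
qed

section \<open>Symmetry and monotonicity of the two bounds\<close>

lemma inner_sq_commute: "inner_sq i j = inner_sq j i"
  and outer_sq_commute: "outer_sq i j = outer_sq j i"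
  by (auto simp: inner_sq_def outer_sq_def max.commute)

lemma inner_sq_abs [simp]: "inner_sq \<bar>i\<bar> j = inner_sq i j" "inner_sq i \<bar>j\<bar> = inner_sq i j"
  by (auto simp: inner_sq_def)

lemma outer_sq_abs [simp]: "outer_sq \<bar>i\<bar> j = outer_sq i j" "outer_sq i \<bar>j\<bar> = outer_sq i j"
  by (auto simp: outer_sq_def)

lemma inner_sq_less_outer_sq: "i \<noteq> 0 \<or> j \<noteq> 0 \<Longrightarrow> inner_sq i j < outer_sq i j"
  by (auto simp: inner_sq_def outer_sq_def max_def)

lemma inner_sq_Suc:
  assumes "0 \<le> i" "0 \<le> j"
  shows "inner_sq i j \<le> inner_sq i (j + 1)"
  using assms by (auto simp: inner_sq_def max_def power2_eq_square algebra_simps)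

lemma inner_sq_mono_snd:
  assumes "\<bar>j\<bar> \<le> \<bar>k\<bar>"
  shows "inner_sq i j \<le> inner_sq i k"
proof -
  have "inner_sq \<bar>i\<bar> (\<bar>j\<bar>) \<le> inner_sq \<bar>i\<bar> (\<bar>j\<bar> + int n)" for n
  proof (induction n)
    case (Suc n)
    then show ?case
      using inner_sq_Suc[of "\<bar>i\<bar>" "\<bar>j\<bar> + int n"] by (simp add: algebra_simps del: inner_sq_abs)
  qed simp
  from this[of "nat (\<bar>k\<bar> - \<bar>j\<bar>)"] show ?thesis using assms by simp
qed

lemma inner_sq_mono_fst: "\<bar>i\<bar> \<le> \<bar>k\<bar> \<Longrightarrow> inner_sq i j \<le> inner_sq k j"
  using inner_sq_mono_snd inner_sq_commute by metis

lemma outer_sq_mono_snd: "\<bar>j\<bar> \<le> \<bar>k\<bar> \<Longrightarrow> outer_sq i j \<le> outer_sq i k"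
  unfolding outer_sq_def using abs_le_square_iff[of j k] by auto

section \<open>The disc as a sublevel set of \<open>inner_sq\<close>\<close>

text \<open>Consecutive pixels of a column have overlapping or adjacent ranges of squared radii, so the
  last pixel inside the disc lies on the circle.\<close>

lemma inner_sq_Suc_le_outer_sq:
  assumes "0 \<le> i" "0 \<le> j"
  shows "inner_sq i (j + 1) \<le> outer_sq i j"
  using assms by (auto simp: inner_sq_def outer_sq_def max_def power2_eq_square algebra_simps)

text \<open>Ends the upward search in \<open>column_top\<close>: a maximum of
  \<open>\<bar>i\<bar>\<close> is absorbed by \<open>i\<^sup>2\<close>, a maximum of
  \<open>int r + 1\<close> by \<open>(int r + 1)\<^sup>2 - (int r)\<^sup>2\<close>.\<close>

lemma inner_sq_eventually_ge: "(int r)\<^sup>2 \<le> inner_sq i (int r + 1)"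
proof -
  have "\<bar>i\<bar> \<le> i\<^sup>2"
    using self_le_power[of "\<bar>i\<bar>" 2] by (cases "i = 0") auto
  then show ?thesis
    by (auto simp: inner_sq_def max_def power2_eq_square algebra_simps)
qed

lemma column_top:
  assumes "0 \<le> i" "0 \<le> j0" "inner_sq i j0 < (int r)\<^sup>2"
  obtains j where "j0 \<le> j" "inner_sq i j < (int r)\<^sup>2" "(int r)\<^sup>2 \<le> inner_sq i (j + 1)"
    "(i, j) \<in> digital_circle r"
proof -
  let ?P = "\<lambda>n. (int r)\<^sup>2 \<le> inner_sq i (j0 + int n)"
  define n where "n = (LEAST n. ?P n)"
  have "inner_sq i (int r + 1) \<le> inner_sq i (j0 + int (Suc r))"
    using assms(2) by (intro inner_sq_mono_snd) simp
  then have "?P (Suc r)" using inner_sq_eventually_ge[of r i] by linarith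
  then have n: "?P n" unfolding n_def by (rule LeastI)
  have "n \<noteq> 0" using n assms(3) by (intro notI) simp
  then obtain l where l: "n = Suc l" using not0_implies_Suc by blast
  then have "\<not> ?P l" using not_less_Least[of l ?P] by (simp add: n_def)
  moreover have "(int r)\<^sup>2 \<le> inner_sq i (j0 + int l + 1)"
    using n l by (simp add: algebra_simps)
  moreover have "inner_sq i (j0 + int l + 1) \<le> outer_sq i (j0 + int l)"
    using assms by (intro inner_sq_Suc_le_outer_sq) auto
  ultimately show thesis
    by (intro that[of "j0 + int l"]) (auto simp: digital_circle_iff)
qed

lemma digital_disc_iff: "(i, j) \<in> digital_disc r \<longleftrightarrow> inner_sq i j < (int r)\<^sup>2"
proof
  assume "(i, j) \<in> digital_disc r"
  then obtain k where k: "(k, j) \<in> digital_circle r" "min 0 k \<le> i" "i \<le> max 0 k"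
    by (auto simp: digital_disc_def)
  then have "inner_sq i j \<le> inner_sq k j" by (intro inner_sq_mono_fst) linarith
  with k(1) show "inner_sq i j < (int r)\<^sup>2" by (simp add: digital_circle_iff)
next
  assume "inner_sq i j < (int r)\<^sup>2"
  \<comment> \<open>The disc is filled along rows while \<open>column_top\<close> climbs a column,
    hence the swap; absolute values move the pixel into the first quadrant.\<close>
  then have "inner_sq \<bar>j\<bar> \<bar>i\<bar> < (int r)\<^sup>2" by (simp add: inner_sq_commute)
  then obtain k where k: "\<bar>i\<bar> \<le> k" "(\<bar>j\<bar>, k) \<in> digital_circle r"
    using column_top by (metis abs_ge_zero)
  define c where "c = (if 0 \<le> i then k else - k)"
  have c: "\<bar>c\<bar> = k" using k(1) by (simp add: c_def)
  have "(c, j) \<in> digital_circle r"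
    using k(2) unfolding digital_circle_iff c[symmetric] by (simp add: inner_sq_commute outer_sq_commute)
  moreover have "min 0 c \<le> i" "i \<le> max 0 c" using k(1) by (auto simp: c_def)
  ultimately show "(i, j) \<in> digital_disc r" by (auto simp: digital_disc_def)
qed

section \<open>Gaps between successive circles\<close>

text \<open>The squared radii of the circles through a pixel are the squares above
  \<open>inner_sq\<close> and up to \<open>outer_sq\<close>; here that range falls between two
  adjacent squares.\<close>

definition gap_pixels :: "nat \<Rightarrow> pixel set" where
  "gap_pixels s = {(x, z). (int s - 1)\<^sup>2 \<le> inner_sq x z \<and> outer_sq x z < (int s)\<^sup>2}"

text \<open>In the disc but off the circle, only the upper inequality can fail; being outside the
  smaller disc is the lower bound on \<open>inner_sq\<close>. With \<open>1 \<le> s\<close> the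
  subtraction on \<open>nat\<close> is exact.\<close>

lemma circle_interior_inter_exterior:
  assumes "1 \<le> s"
  shows "circle_interior s \<inter> circle_exterior (s - 1) = gap_pixels s"
proof -
  have "(x, z) \<in> circle_interior s \<inter> circle_exterior (s - 1) \<longleftrightarrow> (x, z) \<in> gap_pixels s" for x z
  proof -
    have "inner_sq x z < outer_sq x z \<or> x = 0 \<and> z = 0"
      using inner_sq_less_outer_sq by blast
    moreover have "inner_sq 0 0 = - 1" "outer_sq 0 0 = 0"
      by (simp_all add: inner_sq_def outer_sq_def)
    moreover have "- 1 < (int s)\<^sup>2" using zero_le_power2[of "int s"] by linarith
    moreover have "\<not> (int s - 1)\<^sup>2 \<le> - 1" using zero_le_power2[of "int s - 1"] by linarith
    ultimately show ?thesis
      using assms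
      by (auto simp: circle_interior_def circle_exterior_def gap_pixels_def digital_circle_iff
          digital_disc_iff)
  qed
  then show ?thesis by auto
qed

text \<open>For radii \<open>a < b\<close> the pixel would satisfy \<open>(b - 1)\<^sup>2 \<le>
  inner_sq \<le> outer_sq < a\<^sup>2 \<le> (b - 1)\<^sup>2\<close>.\<close>

lemma gap_pixels_disjoint:
  assumes "p \<in> gap_pixels s" "p \<in> gap_pixels t" "1 \<le> s" "1 \<le> t"
  shows "s = t"
proof -
  have "\<not> a < b" if "p \<in> gap_pixels a" "p \<in> gap_pixels b" "1 \<le> a" for a b
  proof
    assume "a < b"
    then have "(int a)\<^sup>2 \<le> (int b - 1)\<^sup>2" by (intro power_mono) auto
    moreover obtain x z where "p = (x, z)" by (cases p)
    moreover have "inner_sq x z \<le> outer_sq x z" by (auto simp: inner_sq_def outer_sq_def)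
    ultimately show False using that by (auto simp: gap_pixels_def)
  qed
  with assms show ?thesis by (metis linorder_neqE_nat)
qed

lemma disc_absentees_eq: "disc_absentees r = (\<Union>s\<in>{1..r}. gap_pixels s)"
proof -
  have "(x, z) \<in> disc_absentees r \<longleftrightarrow> (\<exists>s\<in>{1..r}. (x, z) \<in> gap_pixels s)" for x z
  proof
    assume a: "(x, z) \<in> disc_absentees r"
    \<comment> \<open>The least radius whose disc contains the pixel: minimality yields the lower
      gap inequality, absence from its circle the upper one.\<close>
    define s where "s = (LEAST s. inner_sq x z < (int s)\<^sup>2)"
    have r: "inner_sq x z < (int r)\<^sup>2"
      using a by (simp add: disc_absentees_def digital_disc_iff)
    then have s: "inner_sq x z < (int s)\<^sup>2" "s \<le> r"
      unfolding s_def by (rule LeastI, rule Least_le)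
    have "(x, z) \<notin> digital_circle s"
      using a s(2) by (auto simp: disc_absentees_def disc_union_def)
    then have outer: "outer_sq x z < (int s)\<^sup>2"
      using s(1) by (simp add: digital_circle_iff)
    moreover have "0 \<le> outer_sq x z" by (simp add: outer_sq_def)
    ultimately have "s \<noteq> 0" by (intro notI) simp
    then have "\<not> inner_sq x z < (int (s - 1))\<^sup>2"
      unfolding s_def by (intro not_less_Least) simp
    with outer \<open>s \<noteq> 0\<close> s(2) show "\<exists>s\<in>{1..r}. (x, z) \<in> gap_pixels s"
      by (intro bexI[of _ s]) (auto simp: gap_pixels_def)
  next
    assume "\<exists>s\<in>{1..r}. (x, z) \<in> gap_pixels s"
    then obtain s where s: "1 \<le> s" "s \<le> r" "(int s - 1)\<^sup>2 \<le> inner_sq x z" "outer_sq x z < (int s)\<^sup>2"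
      by (auto simp: gap_pixels_def)
    have "(x, z) \<notin> digital_circle t" for t
    proof (cases "t < s")
      case True
      then have "(int t)\<^sup>2 \<le> (int s - 1)\<^sup>2" by (intro power_mono) auto
      then show ?thesis using s unfolding digital_circle_iff by linarith
    next
      case False
      then have "(int s)\<^sup>2 \<le> (int t)\<^sup>2" by (intro power_mono) auto
      then show ?thesis using s unfolding digital_circle_iff by linarith
    qed
    moreover have "inner_sq x z < (int r)\<^sup>2"
    proof -
      have "(int s)\<^sup>2 \<le> (int r)\<^sup>2" using s by (intro power_mono) auto
      moreover have "inner_sq x z \<le> outer_sq x z" by (auto simp: inner_sq_def outer_sq_def)
      ultimately show ?thesis using s(4) by linarith
    qed
    ultimately show "(x, z) \<in> disc_absentees r"
      using s by (auto simp: disc_absentees_def disc_union_def digital_disc_iff)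
  qed
  then show ?thesis by auto
qed

section \<open>Steps of the generatrix and the bijection\<close>

lemma consecutive_exists:
  assumes "1 \<le> i" "i \<le> int r"
  shows "\<exists>j j'. consecutive r (i - 1, j') (i, j) \<and> j' \<in> {j, j + 1}"
proof -
  have "i\<^sup>2 \<le> (int r)\<^sup>2" using assms by (intro power_mono) auto
  moreover have "inner_sq i 0 = i\<^sup>2 - i" using assms by (simp add: inner_sq_def)
  ultimately have "inner_sq i 0 < (int r)\<^sup>2" using assms by linarith
  \<comment> \<open>The highest generatrix pixel of column \<open>i\<close>, where the arc enters
    it.\<close>
  then obtain t where t: "0 \<le> t" "inner_sq i t < (int r)\<^sup>2" "(int r)\<^sup>2 \<le> inner_sq i (t + 1)"
    "(i, t) \<in> digital_circle r"
    using column_top[of i 0 r] assms by (metis order.refl order_trans zero_le_one)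
  \<comment> \<open>The lowest generatrix pixel of column \<open>i - 1\<close>: row \<open>t\<close>
    if \<open>outer_sq\<close> reaches \<open>(int r)\<^sup>2\<close> there, else the next row
    up.\<close>
  define t' where "t' = (if (int r)\<^sup>2 \<le> outer_sq (i - 1) t then t else t + 1)"
  have below: "outer_sq (i - 1) (t' - 1) < (int r)\<^sup>2" if "1 \<le> t'"
  proof (cases "(int r)\<^sup>2 \<le> outer_sq (i - 1) t")
    case True
    then have "1 \<le> t" using that by (simp add: t'_def)
    \<comment> \<open>The two sides differ by \<open>2 * min i t - 1\<close>, positive since
      \<open>i\<close> and \<open>t\<close> are at least 1.\<close>
    then have "outer_sq (i - 1) (t - 1) \<le> inner_sq i t"
      using assms by (auto simp: inner_sq_def outer_sq_def max_def power2_eq_square algebra_simps)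
    then show ?thesis using True t by (simp add: t'_def)
  qed (simp add: t'_def)
  have "inner_sq (i - 1) t' < (int r)\<^sup>2"
  proof (cases "(int r)\<^sup>2 \<le> outer_sq (i - 1) t")
    case True
    moreover have "inner_sq (i - 1) t \<le> inner_sq i t"
      using assms by (intro inner_sq_mono_fst) auto
    ultimately show ?thesis using t by (simp add: t'_def)
  next
    case False
    then show ?thesis
      using inner_sq_Suc_le_outer_sq[of "i - 1" t] assms t(1) by (simp add: t'_def)
  qed
  moreover have "(int r)\<^sup>2 \<le> outer_sq (i - 1) t'"
  proof (cases "(int r)\<^sup>2 \<le> outer_sq (i - 1) t")
    case False
    have "inner_sq i (t + 1) \<le> outer_sq (i - 1) (t + 1)"
      using assms t(1)
      by (auto simp: inner_sq_def outer_sq_def max_def power2_eq_square algebra_simps)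
    then show ?thesis using t False by (simp add: t'_def)
  qed (simp add: t'_def)
  ultimately have circle': "(i - 1, t') \<in> digital_circle r"
    by (simp add: digital_circle_iff)
  have "0 \<le> t'" using t(1) by (simp add: t'_def)
  have no_lower: "(i - 1, k) \<notin> digital_circle r" if "0 \<le> k" "k < t'" for k
  proof -
    have "outer_sq (i - 1) k \<le> outer_sq (i - 1) (t' - 1)"
      using that by (intro outer_sq_mono_snd) auto
    then show ?thesis using below that by (auto simp: digital_circle_iff)
  qed
  have no_higher: "(i, k) \<notin> digital_circle r" if "t < k" for k
  proof -
    have "inner_sq i (t + 1) \<le> inner_sq i k"
      using that t(1) by (intro inner_sq_mono_snd) auto
    then show ?thesis using t(3) by (auto simp: digital_circle_iff)
  qed
  have "consecutive r (i - 1, t') (i, t)"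
    unfolding consecutive_def
  proof (intro conjI notI)
    assume "\<exists>m\<in>generatrix r. precedes (i - 1, t') m \<and> precedes m (i, t)"
    then obtain a b where "(a, b) \<in> digital_circle r" "0 \<le> b"
      "precedes (i - 1, t') (a, b)" "precedes (a, b) (i, t)"
      by (auto simp: generatrix_def)
    \<comment> \<open>Anything visited in between lies under \<open>t'\<close> in the left column or
      over \<open>t\<close> in the right one.\<close>
    then have "a = i - 1 \<and> b < t' \<or> a = i \<and> t < b"
      by (auto simp: precedes_def)
    then show False using no_lower no_higher \<open>(a, b) \<in> digital_circle r\<close> \<open>0 \<le> b\<close> by blast
  qed (use assms t circle' \<open>0 \<le> t'\<close> in \<open>auto simp: generatrix_def precedes_def\<close>)
  moreover have "t' \<in> {t, t + 1}" by (simp add: t'_def)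
  ultimately show ?thesis by blast
qed

text \<open>If the step ended at two heights, the higher pixel of column \<open>i\<close> would come
  between column \<open>i - 1\<close> and the lower one.\<close>

lemma consecutive_unique:
  assumes "consecutive r (i - 1, j') (i, j)" "consecutive r (i - 1, k') (i, k)"
  shows "j = k"
proof -
  have "\<not> b < a" if "consecutive r (i - 1, a') (i, a)" "consecutive r (i - 1, b') (i, b)" for a a' b b'
  proof
    assume "b < a"
    then have "precedes (i - 1, b') (i, a)" "precedes (i, a) (i, b)"
      by (simp_all add: precedes_def)
    with that show False unfolding consecutive_def by blast
  qed
  with assms show ?thesis by (metis linorder_neqE_linordered_idom)
qed

lemma consecutive_range:
  assumes "consecutive r (i - 1, j') (i, j)"
  shows "1 \<le> i \<and> i \<le> int r"
  using assms digital_circle_bound[of i j r] by (auto simp: consecutive_def generatrix_def)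

lemma mem_absentee_voxels_iff:
  "(x, y, z) \<in> absentee_voxels r \<longleftrightarrow>
    (\<exists>s\<in>{1..r}. \<exists>j'. consecutive r (int s - 1, j') (int s, y) \<and> j' \<in> {y, y + 1} \<and>
       (x, z) \<in> gap_pixels s)"  (is "?L \<longleftrightarrow> ?R")
proof
  assume ?L
  then obtain i j' where c: "consecutive r (i - 1, j') (i, y)" "j' \<in> {y, y + 1}"
    and p: "(x, z) \<in> circle_interior (nat i) \<inter> circle_exterior (nat (i - 1))"
    by (auto simp: absentee_voxels_def in_plane_def)
  define s where "s = nat i"
  have i: "i = int s" "1 \<le> s" "s \<le> r" "nat (i - 1) = s - 1"
    using consecutive_range[OF c(1)] by (auto simp: s_def)
  then have "(x, z) \<in> gap_pixels s"
    using p circle_interior_inter_exterior[OF i(2)] unfolding s_def[symmetric] i(4) by blast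
  with c i show ?R by auto
next
  assume ?R
  then obtain s j' where s: "1 \<le> s" "consecutive r (int s - 1, j') (int s, y)" "j' \<in> {y, y + 1}"
    "(x, z) \<in> gap_pixels s"
    by auto
  have "(x, z) \<in> circle_interior (nat (int s)) \<inter> circle_exterior (nat (int s - 1))"
    using s circle_interior_inter_exterior[OF s(1)] by (simp add: nat_diff_distrib')
  with s(2,3) show ?L
    unfolding absentee_voxels_def in_plane_def by blast
qed

lemma bij_betw_absentees:
  "bij_betw (\<lambda>(x, y, z). (x, z)) (absentee_voxels r) (disc_absentees r)"
  unfolding bij_betw_def
proof
  show "inj_on (\<lambda>(x, y, z). (x, z)) (absentee_voxels r)"
  proof (rule inj_onI, clarsimp)
    fix x y z y'
    assume "(x, y, z) \<in> absentee_voxels r" "(x, y', z) \<in> absentee_voxels r"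
    then obtain s j t j' where st: "1 \<le> s" "(x, z) \<in> gap_pixels s" "1 \<le> t" "(x, z) \<in> gap_pixels t"
      and c: "consecutive r (int s - 1, j) (int s, y)" "consecutive r (int t - 1, j') (int t, y')"
      unfolding mem_absentee_voxels_iff by auto
    \<comment> \<open>The pixel fixes the radius, and the radius fixes the height of the
      step.\<close>
    have "s = t" using st gap_pixels_disjoint by blast
    with c show "y = y'" using consecutive_unique by blast
  qed
  show "(\<lambda>(x, y, z). (x, z)) ` absentee_voxels r = disc_absentees r"
  proof (intro equalityI subsetI)
    fix p assume "p \<in> disc_absentees r"
    then obtain x z s where p: "p = (x, z)" "s \<in> {1..r}" "(x, z) \<in> gap_pixels s"
      by (cases p) (auto simp: disc_absentees_eq)
    then obtain j j' where "consecutive r (int s - 1, j') (int s, j)" "j' \<in> {j, j + 1}"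
      using consecutive_exists[of "int s" r] by auto
    with p have "(x, j, z) \<in> absentee_voxels r"
      unfolding mem_absentee_voxels_iff by blast
    with p(1) show "p \<in> (\<lambda>(x, y, z). (x, z)) ` absentee_voxels r" by force
  qed (auto simp: mem_absentee_voxels_iff disc_absentees_eq)
qed

section \<open>Quadratic growth\<close>

text \<open>The slope of \<open>m \<mapsto> sqrt (m\<^sup>2 + k\<^sup>2)\<close> is slightly above \<open>1 / 2\<close> for \<open>m / k\<close> near
  \<open>0.62\<close>.  Hence advancing \<open>m\<close> by 2 and the radius \<open>s\<close> by 1 makes \<open>m\<^sup>2 + k\<^sup>2 - s\<^sup>2\<close> increase in steps
  too short to jump over the interval \<open>[k, 2 * s - k]\<close>, in which the pixel is an absentee.\<close>

lemma walk_hits_gap: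
  fixes a k n :: int
  assumes n: "1 \<le> n" and k: "5000 * n \<le> k" "k \<le> 5001 * n"
    and a: "3101 * n \<le> a" "a \<le> 3141 * n"
  obtains m s where "a \<le> m" "m < a + 40" "0 \<le> s" "s < 6000 * n"
    "s\<^sup>2 + k \<le> m\<^sup>2 + k\<^sup>2" "m\<^sup>2 + k\<^sup>2 + k < (s + 1)\<^sup>2"
proof -
  define X where "X = a\<^sup>2 + k\<^sup>2 + k"
  \<comment> \<open>The least radius with \<open>X < (s + 1)\<^sup>2\<close>, so the walk starts at
    or below the upper end of the interval, yet not below \<open>- k\<close>.\<close>
  define s where "s = \<lfloor>sqrt (real_of_int X)\<rfloor>"
  have sq_a: "(3101 * n)\<^sup>2 \<le> a\<^sup>2" "a\<^sup>2 \<le> (3141 * n)\<^sup>2"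
    and sq_k: "(5000 * n)\<^sup>2 \<le> k\<^sup>2" "k\<^sup>2 \<le> (5001 * n)\<^sup>2"
    by (rule power_mono; use n k a in linarith)+
  have "n \<le> n\<^sup>2" using n by (simp add: power2_eq_square)
  \<comment> \<open>\<open>5883\<^sup>2 \<le> 3101\<^sup>2 + 5000\<^sup>2\<close> and
    \<open>3141\<^sup>2 + 5001\<^sup>2 + 5001 < 5907\<^sup>2\<close>;
    \<open>n \<le> n\<^sup>2\<close> absorbs the linear term \<open>k\<close>.\<close>
  have X_ge: "(5883 * n)\<^sup>2 \<le> X" and X_less: "X < (5907 * n)\<^sup>2"
    using sq_a sq_k k n \<open>n \<le> n\<^sup>2\<close> unfolding X_def power_mult_distrib by auto
  have "0 \<le> X" using X_ge by (meson order_trans zero_le_power2)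
  have s_nonneg: "0 \<le> s" using \<open>0 \<le> X\<close> by (simp add: s_def)
  have "real_of_int s \<le> sqrt (real_of_int X)" by (simp add: s_def)
  then have "(real_of_int s)\<^sup>2 \<le> real_of_int X"
    using s_nonneg \<open>0 \<le> X\<close> by (metis of_int_0_le_iff power_mono real_sqrt_pow2)
  then have s_le: "s\<^sup>2 \<le> X" by (metis of_int_le_iff of_int_power)
  have "sqrt (real_of_int X) < real_of_int (s + 1)" unfolding s_def by linarith
  then have "real_of_int X < (real_of_int (s + 1))\<^sup>2"
    by (meson not_le real_le_rsqrt)
  then have s_gt: "X < (s + 1)\<^sup>2" by (metis of_int_less_iff of_int_power)
  have "5883 * n < s + 1"
    using power_less_imp_less_base[of "5883 * n" 2 "s + 1"] X_ge s_gt s_nonneg by linarith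
  then have s_lower: "5883 * n \<le> s" by simp
  have s_upper: "s < 5907 * n"
    using power_less_imp_less_base[of s 2 "5907 * n"] X_less s_le n by linarith

  \<comment> \<open>State after \<open>l\<close> moves; the pixel is then in the gap iff
    \<open>k \<le> d l\<close> and \<open>d l \<le> 2 * (s + int l) - k\<close>.\<close>
  define d where "d l = (a + 2 * int l)\<^sup>2 + k\<^sup>2 - (s + int l)\<^sup>2" for l :: nat
  have d_eq: "d l = d 0 + int l * (4 * a - 2 * s) + 3 * (int l)\<^sup>2" for l
    by (simp add: d_def power2_eq_square algebra_simps)
  have d_Suc: "d (Suc l) = d l + (4 * a - 2 * s) + 6 * int l + 3" for l
    by (simp add: d_def power2_eq_square algebra_simps)
  have "- k \<le> d 0" using s_le by (simp add: d_def X_def)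
  \<comment> \<open>Each move gains more than \<open>590 * n\<close>, as
    \<open>590 = 4 * 3101 - 2 * 5907\<close>, and \<open>19 * 590\<close> exceeds the
    \<open>2 * 5001\<close> needed to climb from \<open>- k\<close> to \<open>k\<close>.\<close>
  then have reached: "k \<le> d 19"
    using d_eq[of 19] k a s_upper by simp
  define l where "l = (LEAST l. k \<le> d l)"
  have l: "k \<le> d l" "l \<le> 19"
    unfolding l_def using reached by (rule LeastI, rule Least_le)
  \<comment> \<open>A move adds at most \<open>798 * n + 111\<close>, less than the interval's
    length of at least \<open>1764 * n\<close>, so the first value to reach \<open>k\<close> cannot
    overshoot.\<close>
  have "d l \<le> 2 * (s + int l) - k"
  proof (cases l)
    case 0
    then show ?thesis using s_gt by (simp add: d_def X_def power2_eq_square algebra_simps)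
  next
    case (Suc l')
    then have "d l' < k" using not_less_Least[of l' "\<lambda>l. k \<le> d l"] by (simp add: l_def)
    then show ?thesis using d_Suc[of l'] Suc l(2) k a s_lower n by simp
  qed
  show thesis
  proof (rule that)
    show "(s + int l)\<^sup>2 + k \<le> (a + 2 * int l)\<^sup>2 + k\<^sup>2"
      using l(1) by (simp add: d_def)
    show "(a + 2 * int l)\<^sup>2 + k\<^sup>2 + k < (s + int l + 1)\<^sup>2"
      using \<open>d l \<le> 2 * (s + int l) - k\<close> by (simp add: d_def power2_eq_square algebra_simps)
  qed (use l s_nonneg s_upper n in linarith)+
qed

text \<open>Each of \<open>n\<close> rows holds \<open>n\<close> disjoint blocks of 40 pixels,
  starting at \<open>3101 * n\<close>, with an absentee in each block. The gap indices
  \<open>s + 1\<close> are at most \<open>6000 * n\<close>, hence within \<open>r\<close>.\<close>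

lemma card_disc_absentees_ge:
  assumes "10000 * n \<le> r"
  shows "n\<^sup>2 \<le> card (disc_absentees r)"
proof -
  let ?m = "\<lambda>(b, t) m. 3101 * int n + 40 * int b \<le> m \<and> m < 3101 * int n + 40 * int b + 40 \<and>
    (m, 5000 * int n + int t) \<in> disc_absentees r"
  have ex: "\<exists>m. ?m (b, t) m" if bt: "b < n" "t < n" for b t
  proof -
    define k where "k = 5000 * int n + int t"
    have k: "5000 * int n \<le> k" "k \<le> 5001 * int n" using bt by (auto simp: k_def)
    obtain m s where ms: "3101 * int n + 40 * int b \<le> m" "m < 3101 * int n + 40 * int b + 40"
      "0 \<le> s" "s < 6000 * int n" "s\<^sup>2 + k \<le> m\<^sup>2 + k\<^sup>2" "m\<^sup>2 + k\<^sup>2 + k < (s + 1)\<^sup>2"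
      by (rule walk_hits_gap[OF _ k, of "3101 * int n + 40 * int b"]) (use bt in auto)
    \<comment> \<open>Here \<open>m < 3141 * n\<close>, so the maximum in both bounds is
      \<open>k\<close>.\<close>
    have "0 \<le> m" "m \<le> k" "0 < k" using ms(1,2) k bt by auto
    then have "(m, k) \<in> gap_pixels (nat (s + 1))"
      using ms by (simp add: gap_pixels_def inner_sq_def outer_sq_def)
    moreover have "nat (s + 1) \<in> {1..r}" using ms(3,4) assms by auto
    ultimately have "(m, k) \<in> disc_absentees r" unfolding disc_absentees_eq by blast
    with ms(1,2) show ?thesis by (auto simp: k_def)
  qed
  define f where "f p = (SOME m. ?m p m)" for p
  have f: "?m (b, t) (f (b, t))" if "b < n" "t < n" for b t
    unfolding f_def using ex[OF that] by (rule someI_ex)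
  let ?g = "\<lambda>p. (f p, 5000 * int n + int (snd p))"
  have "inj_on ?g ({..<n} \<times> {..<n})"
  proof (rule inj_onI)
    fix p q assume pq: "p \<in> {..<n} \<times> {..<n}" "q \<in> {..<n} \<times> {..<n}" "?g p = ?g q"
    obtain b t b' t' where eqs: "p = (b, t)" "q = (b', t')" by (cases p, cases q) auto
    have "t = t'" using pq eqs by simp
    moreover have "f (b, t) = f (b', t')" using pq(3) eqs by blast
    \<comment> \<open>A common abscissa lies in both blocks, so their starts differ by less than 40,
      forcing \<open>b = b'\<close>.\<close>
    then have "40 * int b < 40 * int b' + 40" "40 * int b' < 40 * int b + 40"
      using f[of b t] f[of b' t'] pq(1,2) eqs by auto
    ultimately show "p = q" using eqs by simp
  qed
  moreover have "?g ` ({..<n} \<times> {..<n}) \<subseteq> disc_absentees r"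
    using f by fastforce
  ultimately have "card ({..<n} \<times> {..<n}) \<le> card (disc_absentees r)"
    using finite_disc_absentees by (rule card_inj_on_le)
  then show ?thesis by (simp add: card_cartesian_product power2_eq_square)
qed

lemma card_disc_absentees_le: "card (disc_absentees r) \<le> (2 * r + 1)\<^sup>2"
proof -
  have "disc_absentees r \<subseteq> {- int r..int r} \<times> {- int r..int r}"
    using digital_disc_bound by (auto simp: disc_absentees_def)
  then have "card (disc_absentees r) \<le> card ({- int r..int r} \<times> {- int r..int r})"
    by (intro card_mono) auto
  also have "\<dots> = (2 * r + 1)\<^sup>2"
    by (simp add: card_cartesian_product power2_eq_square nat_add_distrib nat_mult_distrib)
  finally show ?thesis .
qed

theorem theorem3:
  shows "(\<forall>r::nat. r > 0 \<longrightarrow> card (absentee_voxels r) = card (disc_absentees r)) \<and>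
         (\<lambda>r::nat. real (card (disc_absentees r))) \<in> \<Theta>[at_top](\<lambda>r. (real r)\<^sup>2)"
proof (intro conjI allI impI)
  fix r :: nat
  show "card (absentee_voxels r) = card (disc_absentees r)"
    using bij_betw_absentees by (rule bij_betw_same_card)
next
  let ?c = "\<lambda>r. real (card (disc_absentees r))"
  have "norm (?c r) \<le> 9 * norm ((real r)\<^sup>2)" if "1 \<le> r" for r
  proof -
    have "?c r \<le> real ((2 * r + 1)\<^sup>2)"
      using card_disc_absentees_le of_nat_le_iff by blast
    also have "\<dots> \<le> real ((3 * r)\<^sup>2)"
      unfolding of_nat_le_iff using that by (intro power_mono) auto
    finally show ?thesis by (simp add: power_mult_distrib)
  qed
  then have "?c \<in> O(\<lambda>r. (real r)\<^sup>2)"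
    by (intro bigoI[of _ 9] eventually_at_top_linorderI[of 1]) auto
  moreover have "(real r)\<^sup>2 \<le> 20000\<^sup>2 * ?c r" if "10000 \<le> r" for r
  proof -
    \<comment> \<open>Rounding down to a multiple of 10000 costs at most a factor 2 once
      \<open>1 \<le> n\<close>.\<close>
    define n where "n = r div 10000"
    have "r < 10000 * n + 10000" "1 \<le> n"
      unfolding n_def using that div_mult_mod_eq[of r 10000] by linarith+
    then have "r \<le> 20000 * n" by simp
    then have "r\<^sup>2 \<le> (20000 * n)\<^sup>2"
      by (rule power_mono) simp
    also have "\<dots> = 20000\<^sup>2 * n\<^sup>2"
      by (rule power_mult_distrib)
    also have "\<dots> \<le> 20000\<^sup>2 * card (disc_absentees r)"
      by (intro mult_left_mono card_disc_absentees_ge) (simp_all add: n_def)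
    finally have "real (r\<^sup>2) \<le> real (20000\<^sup>2 * card (disc_absentees r))"
      unfolding of_nat_le_iff .
    then show ?thesis
      by (simp only: of_nat_mult of_nat_power of_nat_numeral)
  qed
  then have "(\<lambda>r. (real r)\<^sup>2) \<in> O(?c)"
    by (intro bigoI[of _ "20000\<^sup>2"] eventually_at_top_linorderI[of 10000]) auto
  ultimately show "?c \<in> \<Theta>(\<lambda>r. (real r)\<^sup>2)"
    by (simp add: bigtheta_def bigomega_iff_bigo)
qed

end
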